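(* Let $a\in\mathbb{R}$ and let $\nu$ be the standardized free gamma Meixner law, i.e. the compactly supported probability measure that generates the free exponential family with $m_0=0$ and variance function $V(m)=(1+am)^2$. Then its free cumulants satisfy $$c_{k+1}(\nu)=\frac{1}{k+1}\binom{2k}{k}a^{k-1},\qquad k\ge1$$ (with the convention $a^0=1$).
   Context: A compactly supported probability measure $\nu$ with mean $m_0$ generates the free exponential family with variance function $V$ if there is an open interval $(A,B)\ni m_0$ such that $V>0$ on $(A,B)$ and, for every $m\in(A,B)$, $Q_m(dx)=\frac{V(m)}{V(m)+(m-m_0)(m-x)}\,\nu(dx)$ is a probability measure with mean $m$ and variance $V(m)$. For given $m_0$ and analytic $V$ such a measure $\nu$ is unique if it exists. Free cumulants: with $G_\nu(z)=\int\frac{1}{z-x}\nu(dx)$ and $K_\nu=G_\nu^{-1}$ (defined for small $z\neq0$), the $R$-transform $R_\nu(z)=K_\nu(z)-1/z$ is analytic at $0$, and the free cumulants $c_n(\nu)$ are the coefficients in $R_\nu(z)=\sum_{n\ge1}c_n(\nu)z^{n-1}$. *)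

theory Defs
  imports "HOL-Probability.Probability" "HOL-Complex_Analysis.Complex_Analysis"
begin

definition compactly_supported :: "real measure \<Rightarrow> bool" where
  "compactly_supported \<nu> \<longleftrightarrow> (\<exists>K. compact K \<and> (AE x in \<nu>. x \<in> K))"

definition free_exp_member :: "real measure \<Rightarrow> real \<Rightarrow> (real \<Rightarrow> real) \<Rightarrow> real \<Rightarrow> real measure" where
  "free_exp_member \<nu> m0 V m = density \<nu> (\<lambda>x. ennreal (V m / (V m + (m - m0) * (m - x))))"

text \<open>
  Since \<^const>\<open>ennreal\<close> truncates negative numbers and division by zero yields zero,
  the requirement that the formula for \<open>Q\<^sub>m\<close> define a (positive) measure is stated explicitly:
  as \<open>V m > 0\<close>, it says that the denominator is positive almost everywhere.
  A bounded interval suffices, because the defining condition passes to subintervals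
  around \<open>m0\<close>.
\<close>

definition generates_free_exp_family :: "real measure \<Rightarrow> real \<Rightarrow> (real \<Rightarrow> real) \<Rightarrow> bool" where
  "generates_free_exp_family \<nu> m0 V \<longleftrightarrow>
     (LINT x|\<nu>. x) = m0 \<and>
     (\<exists>A B. A < m0 \<and> m0 < B \<and>
       (\<forall>m\<in>{A<..<B}. V m > 0 \<and>
          (AE x in \<nu>. V m + (m - m0) * (m - x) > 0) \<and>
          prob_space (free_exp_member \<nu> m0 V m) \<and>
          (LINT x|free_exp_member \<nu> m0 V m. x) = m \<and>
          (LINT x|free_exp_member \<nu> m0 V m. (x - m)\<^sup>2) = V m))"

definition cauchy_transform :: "real measure \<Rightarrow> complex \<Rightarrow> complex" where
  "cauchy_transform \<nu> z = (LINT x|\<nu>. 1 / (z - complex_of_real x))"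

text \<open>
  For compactly supported \<open>\<nu>\<close>, \<open>G\<^sub>\<nu>\<close> is injective near infinity and maps neighbourhoods of
  infinity onto punctured neighbourhoods of \<open>0\<close>. Hence a function inverting \<open>G\<^sub>\<nu>\<close> near
  infinity exists, and any two of them agree for all small \<open>z \<noteq> 0\<close>. Only this germ at \<open>0\<close>
  matters below; \<^const>\<open>remove_sings\<close> supplies the value of \<open>R\<^sub>\<nu>\<close> at \<open>0\<close>.
\<close>

definition cauchy_inverse :: "real measure \<Rightarrow> complex \<Rightarrow> complex" where
  "cauchy_inverse \<nu> = (SOME K. \<forall>\<^sub>F w in at_infinity. K (cauchy_transform \<nu> w) = w)"

definition R_transform :: "real measure \<Rightarrow> complex \<Rightarrow> complex" where
  "R_transform \<nu> = remove_sings (\<lambda>z. cauchy_inverse \<nu> z - 1 / z)"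

text \<open>The free cumulants are indexed from \<open>n = 1\<close>; the value at \<open>n = 0\<close> is irrelevant.\<close>

definition free_cumulant :: "real measure \<Rightarrow> nat \<Rightarrow> complex" where
  "free_cumulant \<nu> n = fps_nth (fps_expansion (R_transform \<nu>) 0) (n - 1)"

end

(*
  The total mass condition on Q_m says G(m + V(m)/m) = m/V(m) for small real m, and by analytic
  continuation for small complex m. Hence K(m/V(m)) = m + V(m)/m, that is R(m/V(m)) = m: the
  R-transform is the compositional inverse of m/V(m). For V(m) = (1 + a m)^2 this inverse is
  R(z) = z C(a z)^2, where C(t) = 1 + t C(t)^2 is the generating function of the Catalan numbers.
*)

theory Submission
  imports Defs
begin

section \<open>Catalan numbers from a quadratic equation for formal power series\<close>

lemma fps_nth_catalan:
  fixes D :: "'a :: field_char_0 fps"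
  assumes D: "D = 1 + fps_X * D\<^sup>2"
  shows "fps_nth D n = of_nat ((2 * n) choose n) / of_nat (n + 1)"
proof -
  \<comment> \<open>\<open>S\<close> is the square root of \<open>1 - 4 X\<close>; its differential equation gives the recurrence for \<open>D\<close>.\<close>
  define S where "S = 1 - 2 * fps_X * D"
  have "S\<^sup>2 = 1 - 4 * fps_X * (D - fps_X * D\<^sup>2)"
    by (simp add: S_def power2_eq_square algebra_simps)
  also have "D - fps_X * D\<^sup>2 = 1"
    by (subst D) simp
  finally have S2: "S\<^sup>2 = 1 - 4 * fps_X" by simp
  have "fps_deriv (S\<^sup>2) = - 4"
    unfolding S2 by (simp add: fps_deriv_mult)
  hence "2 * S * fps_deriv S = - 4"
    by (simp add: power2_eq_square algebra_simps fps_deriv_mult)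
  \<comment> \<open>Another factor \<open>S\<close> turns \<open>S * S\<close> into the polynomial
    \<open>1 - 4 * fps_X\<close>; the differential equation becomes linear, and comparing
    coefficients gives a two-term recurrence.\<close>
  hence "S * (2 * S * fps_deriv S) = S * (- 4)"
    by simp
  hence "2 * (S\<^sup>2 * fps_deriv S) = 2 * (- 2 * S)"
    by (simp add: power2_eq_square algebra_simps)
  hence "S\<^sup>2 * fps_deriv S = - 2 * S"
    by (metis mult_left_cancel zero_neq_numeral)
  hence ode: "fps_deriv S - 4 * (fps_X * fps_deriv S) = - 2 * S"
    by (simp add: S2 algebra_simps)
  have S_Suc: "fps_nth S (Suc n) = - 2 * fps_nth D n" for n
    by (simp add: S_def mult.assoc fps_numeral_nth numeral_fps_const)
  have rec: "of_nat (n + 2) * fps_nth D (Suc n) = of_nat (4 * n + 2) * fps_nth D n" for n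
  proof -
    have "fps_nth (fps_deriv S - 4 * (fps_X * fps_deriv S)) (Suc n) = fps_nth (- 2 * S) (Suc n)"
      by (simp only: ode)
    hence "2 * (of_nat (n + 2) * fps_nth D (Suc n)) = 2 * (of_nat (4 * n + 2) * fps_nth D n)"
      by (simp add: S_Suc numeral_fps_const algebra_simps)
    thus ?thesis
      by (metis mult_left_cancel zero_neq_numeral)
  qed
  show ?thesis
  proof (induction n)
    case 0
    show ?case by (subst D) simp
  next
    case (Suc n)
    \<comment> \<open>Once the denominators \<open>n + 1\<close> and \<open>n + 2\<close> are
      restored, this ratio of central binomial coefficients is the ratio in
      \<open>rec\<close>.\<close>
    have "(n + 1) * ((2 * Suc n) choose Suc n) = (4 * n + 2) * ((2 * n) choose n)"
    proof -
      have "(n + 1) * ((2 * Suc n) choose Suc n) = (2 * n + 2) * ((2 * n + 1) choose n)"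
        using Suc_times_binomial[of n "2 * n + 1"] by simp
      moreover have "(n + 1) * ((2 * n + 1) choose n) = (2 * n + 1) * ((2 * n) choose n)"
        using Suc_times_binomial[of n "2 * n"] central_binomial_odd[of "2 * n + 1"] by simp
      ultimately show ?thesis by simp
    qed
    hence bin: "of_nat (n + 1) * of_nat ((2 * Suc n) choose Suc n)
        = (of_nat (4 * n + 2) * of_nat ((2 * n) choose n) :: 'a)"
      by (metis of_nat_mult)
    have "of_nat (n + 1) * (of_nat (n + 2) * fps_nth D (Suc n))
        = of_nat (4 * n + 2) * (of_nat (n + 1) * fps_nth D n)"
      unfolding rec by (simp only: mult_ac)
    also have "of_nat (n + 1) * fps_nth D n = of_nat ((2 * n) choose n)"
      unfolding Suc.IH using of_nat_neq_0[of n, where 'a = 'a] by simp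
    also note bin[symmetric]
    finally have "of_nat (n + 2) * fps_nth D (Suc n) = of_nat ((2 * Suc n) choose Suc n)"
      using of_nat_neq_0[of n, where 'a = 'a] by simp
    thus ?case
      using of_nat_neq_0[of "Suc n", where 'a = 'a] by (simp add: field_simps)
  qed
qed

section \<open>The Catalan generating function as an analytic function\<close>

text \<open>The usual \<open>(1 - csqrt (1 - 4 * t)) / (2 * t)\<close> with its numerator
  rationalised: no singularity remains at \<open>t = 0\<close>, and the denominator never vanishes
  because principal roots have nonnegative real part.\<close>

definition catalan_gf :: "complex \<Rightarrow> complex" where
  "catalan_gf t = 2 / (1 + csqrt (1 - 4 * t))"

lemma catalan_gf_denom: "1 + csqrt z \<noteq> 0"
proof
  assume "1 + csqrt z = 0"
  hence "Re (1 + csqrt z) = 0" by (simp only: zero_complex.sel)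
  thus False using Re_csqrt[of z] by (simp del: csqrt.simps)
qed

lemma catalan_gf_nonzero: "catalan_gf t \<noteq> 0"
  using catalan_gf_denom by (simp add: catalan_gf_def)

lemma catalan_gf_eq: "catalan_gf t = 1 + t * (catalan_gf t)\<^sup>2"
proof -
  define s where "s = csqrt (1 - 4 * t)"
  \<comment> \<open>Expressing \<open>t\<close> through \<open>s\<close> leaves a rational identity
    in \<open>s\<close>, so the branch cut of the root is harmless.\<close>
  have "t = (1 - s\<^sup>2) / 4" by (simp add: s_def)
  thus ?thesis
    using catalan_gf_denom[of "1 - 4 * t"]
    unfolding catalan_gf_def s_def[symmetric]
    by (simp add: divide_simps power2_eq_square) (simp add: algebra_simps)
qed

lemma catalan_gf_analytic: "catalan_gf analytic_on {0}"
  unfolding catalan_gf_def using catalan_gf_denom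
  by (intro analytic_intros) auto

text \<open>Power series expansions are unique, so the functional equation of
  \<open>catalan_gf\<close> passes to its expansion.\<close>

lemma catalan_gf_expansion:
  obtains D where "catalan_gf has_fps_expansion D" "D = 1 + fps_X * D\<^sup>2"
proof -
  define D where "D = fps_expansion catalan_gf 0"
  have D: "catalan_gf has_fps_expansion D"
    unfolding D_def by (rule analytic_at_imp_has_fps_expansion_0[OF catalan_gf_analytic])
  have "(\<lambda>t. 1 + t * (catalan_gf t)\<^sup>2) has_fps_expansion 1 + fps_X * D\<^sup>2"
    by (intro fps_expansion_intros D)
  hence "catalan_gf has_fps_expansion 1 + fps_X * D\<^sup>2"
    by (simp only: catalan_gf_eq[symmetric])
  with D have "D = 1 + fps_X * D\<^sup>2"
    using fps_expansion_unique_complex by blast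
  with D show ?thesis by (rule that)
qed

text \<open>Scaling by \<open>a\<close> contributes \<open>a ^ n\<close>, and by the quadratic
  equation the coefficients of \<open>D\<^sup>2\<close> are those of \<open>D\<close> shifted by
  one, whence the binomial with \<open>Suc n\<close>.\<close>

lemma gamma_Meixner_R_coeff:
  fixes a :: complex
  shows "fps_nth (fps_expansion (\<lambda>z. z * (catalan_gf (a * z))\<^sup>2) 0) (Suc n)
    = of_nat ((2 * Suc n) choose Suc n) / of_nat (n + 2) * a ^ n"
proof -
  obtain D where D: "catalan_gf has_fps_expansion D" "D = 1 + fps_X * D\<^sup>2"
    by (rule catalan_gf_expansion)
  have lin: "(\<lambda>z. a * z) has_fps_expansion fps_const a * fps_X"
    by (intro fps_expansion_intros)
  have "(\<lambda>z. catalan_gf (a * z)) has_fps_expansion (D oo (fps_const a * fps_X))"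
    using has_fps_expansion_compose[OF D(1) lin] by (simp add: o_def)
  hence "(\<lambda>z. z * (catalan_gf (a * z))\<^sup>2) has_fps_expansion
      fps_X * (D oo (fps_const a * fps_X))\<^sup>2"
    by (intro fps_expansion_intros)
  hence "fps_expansion (\<lambda>z. z * (catalan_gf (a * z))\<^sup>2) 0
      = fps_X * (D oo (fps_const a * fps_X))\<^sup>2"
    using fps_expansion_unique_complex analytic_at_imp_has_fps_expansion_0
      has_fps_expansion_imp_analytic_0 by blast
  also have "(D oo (fps_const a * fps_X))\<^sup>2 = D\<^sup>2 oo (fps_const a * fps_X)"
    by (simp add: fps_compose_power)
  also have "fps_nth (fps_X * (D\<^sup>2 oo (fps_const a * fps_X))) (Suc n) = a ^ n * fps_nth (D\<^sup>2) n"
    by (simp add: fps_compose_linear)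
  also have "fps_nth (D\<^sup>2) n = fps_nth (1 + fps_X * D\<^sup>2) (Suc n)"
    by simp
  also have "\<dots> = fps_nth D (Suc n)"
    by (simp only: D(2)[symmetric])
  finally show ?thesis
    by (simp add: fps_nth_catalan[OF D(2)])
qed

section \<open>Analyticity of the Cauchy transform at infinity\<close>

text \<open>The Cauchy transform in the coordinate \<open>u = 1 / z\<close> at infinity, so that its value
  at \<open>u = 0\<close> is the correct limit rather than the junk value coming from \<open>1 / 0\<close>.\<close>

definition cauchy_transform_inf :: "real measure \<Rightarrow> complex \<Rightarrow> complex" where
  "cauchy_transform_inf \<nu> u = (LINT x|\<nu>. u / (1 - u * complex_of_real x))"

lemma cauchy_transform_inf_0 [simp]: "cauchy_transform_inf \<nu> 0 = 0"
  by (simp add: cauchy_transform_inf_def)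

lemma cauchy_transform_inverse:
  assumes "u \<noteq> 0"
  shows "cauchy_transform \<nu> (1 / u) = cauchy_transform_inf \<nu> u"
proof -
  \<comment> \<open>If \<open>1 - u * x = 0\<close>, both sides divide by zero and equal 0, so the
    identity holds for every \<open>x\<close>.\<close>
  have "1 / (1 / u - complex_of_real x) = u / (1 - u * complex_of_real x)" for x
    using assms by (cases "1 - u * complex_of_real x = 0") (auto simp: field_simps)
  thus ?thesis by (simp add: cauchy_transform_def cauchy_transform_inf_def)
qed

text \<open>The integrand is a geometric series in \<open>u * x\<close>, and bounded support permits
  termwise integration; the result is the moment series, convergent for
  \<open>norm u < 1 / B\<close>.\<close>

lemma cauchy_transform_inf_analytic:
  assumes "real_distribution \<nu>" "compactly_supported \<nu>"
  shows "cauchy_transform_inf \<nu> analytic_on {0}"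
proof -
  interpret real_distribution \<nu> by fact
  obtain K where K: "compact K" "AE x in \<nu>. x \<in> K"
    using assms(2) by (auto simp: compactly_supported_def)
  obtain B where B: "B > 0" "\<And>x. x \<in> K \<Longrightarrow> \<bar>x\<bar> \<le> B"
    using compact_imp_bounded[OF K(1)] by (auto simp: bounded_pos)
  have AE_B: "AE x in \<nu>. \<bar>x\<bar> \<le> B"
    using K(2) by eventually_elim (rule B)
  define c where "c n = (LINT x|\<nu>. complex_of_real x ^ n)" for n :: nat
  \<comment> \<open>The moment \<open>c k\<close> belongs to \<open>u ^ Suc k\<close>, hence the
    zero constant term; \<open>u - 0\<close> exhibits the centre of the power series.\<close>
  have sums: "(\<lambda>n. (case n of 0 \<Rightarrow> 0 | Suc k \<Rightarrow> c k) * (u - 0) ^ n) sums cauchy_transform_inf \<nu> u"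
    if u: "u \<in> ball 0 (1 / B)" for u
  proof -
    define q where "q = norm u * B"
    have q: "0 \<le> q" "q < 1"
      using u B(1) by (auto simp: q_def field_simps)
    let ?f = "\<lambda>n x. u ^ Suc n * complex_of_real x ^ n"
    have norm_f: "norm (?f n x) \<le> norm u * q ^ n" if "\<bar>x\<bar> \<le> B" for n x
    proof -
      have "norm (?f n x) = norm u * (norm u * \<bar>x\<bar>) ^ n"
        by (simp add: norm_mult norm_power power_mult_distrib)
      also have "\<dots> \<le> norm u * q ^ n"
        unfolding q_def using that by (intro mult_left_mono power_mono) auto
      finally show ?thesis .
    qed
    have int_f: "integrable \<nu> (?f n)" for n
      by (rule integrable_const_bound[where B = "norm u * q ^ n"])
         (use AE_B in eventually_elim, rule norm_f, auto)
    have summ: "summable (\<lambda>n. norm u * q ^ n)"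
      using q by (intro summable_mult summable_geometric) auto
    have "(\<lambda>n. integral\<^sup>L \<nu> (?f n)) sums (LINT x|\<nu>. (\<Sum>n. ?f n x))"
    proof (rule sums_integral[OF int_f])
      show "AE x in \<nu>. summable (\<lambda>n. norm (?f n x))"
        using AE_B
      proof eventually_elim
        case (elim x)
        show ?case
          by (rule summable_comparison_test'[OF summ, of 0]) (use norm_f[OF elim] in simp)
      qed
      have "norm (LINT x|\<nu>. norm (?f n x)) \<le> norm u * q ^ n" for n
      proof -
        have "(LINT x|\<nu>. norm (?f n x)) \<le> (LINT x|\<nu>. norm u * q ^ n)"
          by (rule integral_mono_AE) (use AE_B norm_f int_f in \<open>auto intro!: integrable_norm\<close>)
        moreover have "prob UNIV = 1" using prob_space by simp
        ultimately show ?thesis by simp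
      qed
      thus "summable (\<lambda>n. LINT x|\<nu>. norm (?f n x))"
        by (intro summable_comparison_test'[OF summ, of 0]) auto
    qed
    also have "(LINT x|\<nu>. (\<Sum>n. ?f n x)) = cauchy_transform_inf \<nu> u"
      unfolding cauchy_transform_inf_def
    proof (rule integral_cong_AE)
      show "AE x in \<nu>. (\<Sum>n. ?f n x) = u / (1 - u * complex_of_real x)"
        using AE_B
      proof eventually_elim
        case (elim x)
        have "norm (u * complex_of_real x) \<le> q"
          using elim by (auto simp: norm_mult q_def intro!: mult_left_mono)
        hence "(\<lambda>n. u * (u * complex_of_real x) ^ n) sums (u * (1 / (1 - u * complex_of_real x)))"
          using q by (intro sums_mult geometric_sums) auto
        thus ?case
          by (simp add: sums_iff power_mult_distrib mult_ac)
      qed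
    qed auto
    also have "(\<lambda>n. integral\<^sup>L \<nu> (?f n)) = (\<lambda>n. c n * u ^ Suc n)"
      by (simp add: c_def mult_ac)
    finally have "(\<lambda>n. c n * u ^ Suc n) sums cauchy_transform_inf \<nu> u" .
    thus ?thesis
      using sums_Suc[of "\<lambda>n. (case n of 0 \<Rightarrow> 0 | Suc k \<Rightarrow> c k) * (u - 0) ^ n"] by simp
  qed
  have "cauchy_transform_inf \<nu> analytic_on ball 0 (1 / B)"
    by (rule power_series_analytic[OF sums])
  thus ?thesis
    using B(1) by (rule_tac analytic_on_subset) auto
qed

section \<open>Local inversion and the R-transform\<close>

text \<open>Full rather than punctured neighbourhoods let eventual properties be pulled back along
  \<open>f\<close> even where \<open>f\<close> takes the value \<open>w\<close>.\<close>

lemma analytic_at_imp_tendsto_nhds: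
  assumes "f analytic_on {z}" "f z = w"
  shows "filterlim f (nhds w) (nhds z)"
  using analytic_at_imp_isCont[OF assms(1)]
  unfolding assms(2)[symmetric] by (simp add: continuous_at tendsto_at_iff_tendsto_nhds)

text \<open>The chain rule gives \<open>deriv g 0 * deriv \<psi> 0 = 1\<close>, so \<open>g\<close>
  is injective near 0; \<open>\<psi> (g u)\<close> and \<open>u\<close> have the same image under
  \<open>g\<close> and therefore coincide.\<close>

lemma right_inverse_imp_left_inverse:
  fixes g \<psi> :: "complex \<Rightarrow> complex"
  assumes g: "g analytic_on {0}" "g 0 = 0" and \<psi>: "\<psi> analytic_on {0}" "\<psi> 0 = 0"
  assumes right: "\<forall>\<^sub>F z in nhds 0. g (\<psi> z) = z"
  shows "\<forall>\<^sub>F u in nhds 0. \<psi> (g u) = u"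
proof -
  have "(g has_field_derivative deriv g 0) (at (\<psi> 0))" 
    using g(1) \<psi>(2) by (simp add: analytic_derivI)
  moreover have "(\<psi> has_field_derivative deriv \<psi> 0) (at 0)"
    using \<psi>(1) by (simp add: analytic_derivI)
  ultimately have "((\<lambda>z. g (\<psi> z)) has_field_derivative deriv g 0 * deriv \<psi> 0) (at 0)"
    by (rule DERIV_chain2)
  hence "((\<lambda>z. z) has_field_derivative deriv g 0 * deriv \<psi> 0) (at 0)"
    using right by (subst (asm) DERIV_cong_ev[OF refl _ refl])
  hence "deriv g 0 * deriv \<psi> 0 = 1"
    using DERIV_unique DERIV_ident by blast
  hence dnz: "deriv g 0 \<noteq> 0" by auto
  obtain S where S: "open S" "0 \<in> S" "g holomorphic_on S"
    using g(1) by (auto simp: analytic_at)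
  obtain r where r: "r > 0" "inj_on g (ball 0 r)"
    using has_complex_derivative_locally_injective[OF S(3,2,1) dnz] by metis
  have lim_g: "filterlim g (nhds 0) (nhds 0)"
    by (rule analytic_at_imp_tendsto_nhds[OF g])
  have lim_\<psi>: "filterlim \<psi> (nhds 0) (nhds 0)"
    by (rule analytic_at_imp_tendsto_nhds[OF \<psi>])
  have ball: "\<forall>\<^sub>F u :: complex in nhds 0. u \<in> ball 0 r"
    using r(1) by (intro eventually_nhds_in_open) auto
  have "\<forall>\<^sub>F u in nhds 0. \<psi> (g u) \<in> ball 0 r"
    by (rule eventually_compose_filterlim[OF ball filterlim_compose[OF lim_\<psi> lim_g]])
  moreover have "\<forall>\<^sub>F u in nhds 0. g (\<psi> (g u)) = g u"
    by (rule eventually_compose_filterlim[OF right lim_g])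
  ultimately show ?thesis using ball
    by eventually_elim (rule inj_onD[OF r(2)])
qed

text \<open>For small \<open>z \<noteq> 0\<close> the argument in \<open>right\<close> is the
  reciprocal of \<open>1 / z + \<mu> z\<close>, so this sum inverts the Cauchy transform near
  infinity; subtracting \<open>1 / z\<close> leaves \<mu>.\<close>

lemma R_transform_eqI:
  assumes \<nu>: "real_distribution \<nu>" "compactly_supported \<nu>"
    and \<mu>: "\<mu> analytic_on {0}"
    and right: "\<forall>\<^sub>F z in nhds 0. cauchy_transform_inf \<nu> (z / (1 + z * \<mu> z)) = z"
  shows "\<forall>\<^sub>F z in nhds 0. R_transform \<nu> z = \<mu> z"
proof -
  define \<psi> where "\<psi> z = z / (1 + z * \<mu> z)" for z
  have \<psi>: "\<psi> analytic_on {0}" "\<psi> 0 = 0"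
    unfolding \<psi>_def by (auto intro!: analytic_intros \<mu>)
  have lim_\<psi>: "filterlim \<psi> (nhds 0) (nhds 0)"
    by (rule analytic_at_imp_tendsto_nhds[OF \<psi>])
  have "\<forall>\<^sub>F z in nhds 0. 1 + z * \<mu> z \<noteq> 0"
  proof -
    have "filterlim (\<lambda>z. 1 + z * \<mu> z) (nhds 1) (nhds 0)"
      by (rule analytic_at_imp_tendsto_nhds) (auto intro!: analytic_intros \<mu>)
    thus ?thesis using tendsto_imp_eventually_ne by fastforce
  qed
  hence recip: "\<forall>\<^sub>F z in at 0. \<psi> z \<noteq> 0 \<and> 1 / \<psi> z = 1 / z + \<mu> z"
    unfolding eventually_at_filter
    by eventually_elim (auto simp: \<psi>_def field_simps)
  have right': "\<forall>\<^sub>F z in nhds 0. cauchy_transform_inf \<nu> (\<psi> z) = z"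
    unfolding \<psi>_def by (rule right)
  \<comment> \<open>The choice in \<open>cauchy_inverse\<close> is specified by a left inverse
    property, so a left inverse must be exhibited before the chosen one can be used.\<close>
  have left: "\<forall>\<^sub>F u in nhds 0. \<psi> (cauchy_transform_inf \<nu> u) = u"
    by (rule right_inverse_imp_left_inverse[OF cauchy_transform_inf_analytic[OF \<nu>]
          cauchy_transform_inf_0 \<psi> right'])
  have lim_inv: "filterlim (\<lambda>w::complex. 1 / w) (at 0) at_infinity"
    by (simp add: divide_inverse filterlim_inverse_at_iff filterlim_ident)
  have "\<forall>\<^sub>F u in at 0. 1 / \<psi> (cauchy_transform \<nu> (1 / u)) = 1 / u"
    using left unfolding eventually_at_filter
    by eventually_elim (simp add: cauchy_transform_inverse)
  from eventually_compose_filterlim[OF this lim_inv]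
  have ex: "\<forall>\<^sub>F w in at_infinity. (\<lambda>z. 1 / \<psi> z) (cauchy_transform \<nu> w) = w"
    by simp
  have K: "\<forall>\<^sub>F w in at_infinity. cauchy_inverse \<nu> (cauchy_transform \<nu> w) = w"
    unfolding cauchy_inverse_def by (rule someI[of _ "\<lambda>z. 1 / \<psi> z"]) (rule ex)
  have "filterlim \<psi> (at 0) (at 0)"
    unfolding filterlim_at using recip lim_\<psi> tendsto_at_iff_tendsto_nhds[of \<psi> 0] \<psi>(2)
    by (auto elim: eventually_mono)
  hence "filterlim (\<lambda>z. 1 / \<psi> z) at_infinity (at 0)"
    using filterlim_compose[OF filterlim_inverse_at_infinity] by (simp add: divide_inverse)
  \<comment> \<open>At \<open>w = 1 / \<psi> z\<close> the Cauchy transform equals \<open>z\<close>,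
    so every admissible choice of inverse is forced to take the value \<open>1 / \<psi> z\<close> at
    \<open>z\<close>.\<close>
  from eventually_compose_filterlim[OF K this]
  have "\<forall>\<^sub>F z in at 0. cauchy_inverse \<nu> (cauchy_transform \<nu> (1 / \<psi> z)) = 1 / \<psi> z" .
  moreover have "\<forall>\<^sub>F z in at 0. cauchy_transform_inf \<nu> (\<psi> z) = z"
    using right' unfolding eventually_at_filter by eventually_elim simp
  ultimately have "\<forall>\<^sub>F z in at 0. cauchy_inverse \<nu> z - 1 / z = \<mu> z"
    using recip
  proof eventually_elim
    case (elim z)
    thus ?case using cauchy_transform_inverse[of "\<psi> z" \<nu>] by simp
  qed
  then obtain S where S: "open S" "0 \<in> S"
    and eq: "\<And>z. z \<in> S - {0} \<Longrightarrow> cauchy_inverse \<nu> z - 1 / z = \<mu> z"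
    unfolding eventually_at_topological by blast
  have "\<forall>\<^sub>F y in nhds 0. y \<in> S"
    by (rule eventually_nhds_in_open[OF S])
  moreover have "\<forall>\<^sub>F y in nhds 0. remove_sings \<mu> y = \<mu> y"
    by (rule eventually_remove_sings_eq_nhds[OF \<mu>])
  ultimately show ?thesis
  proof eventually_elim
    case (elim y)
    \<comment> \<open>\<open>remove_sings\<close> takes a limit at each point, so agreement is
      needed on a punctured neighbourhood of every \<open>y\<close> near 0, and that neighbourhood
      must also avoid 0.\<close>
    have "\<forall>\<^sub>F z in at y. z \<in> S - {0}"
    proof (cases "y = 0")
      case True
      thus ?thesis using eventually_at_in_open[OF S] by simp
    next
      case False
      thus ?thesis using elim(1) S(1) by (intro eventually_at_in_open') auto
    qed
    hence "\<forall>\<^sub>F z in at y. cauchy_inverse \<nu> z - 1 / z = \<mu> z"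
      by eventually_elim (rule eq)
    hence "R_transform \<nu> y = remove_sings \<mu> y"
      unfolding R_transform_def by (rule remove_sings_cong) simp
    thus ?case using elim(2) by simp
  qed
qed

section \<open>From the exponential family to the R-transform\<close>

text \<open>Multiplied by \<open>m / V m\<close>, the density of \<open>Q_m\<close> is the Cauchy
  kernel at \<open>m + V m / m\<close>, and its total mass is 1. The reciprocal of that point is
  written in a form that also makes sense at \<open>m = 0\<close>.\<close>

lemma cauchy_transform_inf_of_real:
  assumes gen: "generates_free_exp_family \<nu> 0 V"
    and \<nu>: "real_distribution \<nu>"
  shows "\<forall>\<^sub>F m in nhds 0. V m > 0 \<and>
    cauchy_transform_inf \<nu> (complex_of_real (m / V m / (1 + m * (m / V m)))) = complex_of_real (m / V m)"
proof -
  interpret real_distribution \<nu> by fact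
  obtain A B where AB: "A < 0" "0 < B"
    and fam: "\<And>m. m \<in> {A<..<B} \<Longrightarrow> V m > 0 \<and> (AE x in \<nu>. V m + (m - 0) * (m - x) > 0) \<and>
      prob_space (free_exp_member \<nu> 0 V m)"
    using gen unfolding generates_free_exp_family_def by blast
  have "\<forall>\<^sub>F m in nhds 0. m \<in> {A<..<B}"
    using AB by (intro eventually_nhds_in_open) auto
  thus ?thesis
  proof eventually_elim
    case (elim m)
    define h where "h = m / V m"
    define f where "f x = V m / (V m + m * (m - x))" for x
    have V: "V m > 0" using fam[OF elim] by simp
    \<comment> \<open>Nonnegativity lets the mass, given as an \<open>ennreal\<close> integral, be
      read as a real integral of \<open>f\<close>.\<close>
    have pos: "AE x in \<nu>. 0 \<le> f x"
      using fam[OF elim] by (auto simp: f_def elim: eventually_mono)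
    have [measurable]: "f \<in> borel_measurable \<nu>"
      unfolding f_def by measurable
    have "(\<integral>\<^sup>+x. ennreal (f x) \<partial>\<nu>) = emeasure (density \<nu> f) (space (density \<nu> f))"
      by (simp add: emeasure_density cong: nn_integral_cong)
    also have "density \<nu> f = free_exp_member \<nu> 0 V m"
      by (simp add: free_exp_member_def f_def)
    also have "emeasure (free_exp_member \<nu> 0 V m) (space (free_exp_member \<nu> 0 V m)) = 1"
      using fam[OF elim] by (simp add: prob_space.emeasure_space_1)
    finally have "integral\<^sup>L \<nu> f = 1"
      using nn_integral_eq_integrable[of f \<nu> 1] pos by simp
    define u where "u = h / (1 + m * h)"
    have nz: "1 + m * h > 0"
      unfolding h_def using V by (auto intro!: add_pos_nonneg)
    have u: "u = m / (V m + m * m)"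
      using V nz by (simp add: u_def h_def field_simps)
    define d where "d = V m + m * m"
    have d: "d > 0" using V by (auto simp: d_def intro!: add_pos_nonneg)
    \<comment> \<open>Valid for every \<open>x\<close>: where \<open>d = m * x\<close>, both sides
      are 0 by division by zero.\<close>
    have "u / (1 - u * x) = h * f x" for x
    proof -
      have "1 - u * x = (d - m * x) / d"
        using d by (simp add: u d_def[symmetric] diff_divide_distrib)
      hence "u / (1 - u * x) = m / (d - m * x)"
        using d by (simp add: u d_def[symmetric])
      also have "m / (d - m * x) = h * f x"
        using V by (simp add: h_def f_def d_def algebra_simps)
      finally show ?thesis .
    qed
    hence eq: "complex_of_real u / (1 - complex_of_real u * complex_of_real x) = complex_of_real (h * f x)" for x
      by (metis of_real_1 of_real_diff of_real_divide of_real_mult)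
    have "cauchy_transform_inf \<nu> (complex_of_real u) = (LINT x|\<nu>. complex_of_real (h * f x))"
      by (simp only: cauchy_transform_inf_def eq)
    also have "\<dots> = complex_of_real h"
      unfolding integral_complex_of_real using \<open>integral\<^sup>L \<nu> f = 1\<close> by simp
    finally show ?case using V by (simp add: u_def h_def)
  qed
qed

text \<open>The identity theorem: real points accumulate at 0, so the zero of \<open>f - g\<close>
  there is not isolated.\<close>

lemma analytic_eq_of_real_imp_eventually_eq:
  fixes f g :: "complex \<Rightarrow> complex"
  assumes "f analytic_on {0}" "g analytic_on {0}"
    and eq: "\<forall>\<^sub>F x in nhds 0. f (complex_of_real x) = g (complex_of_real x)"
  shows "\<forall>\<^sub>F z in nhds 0. f z = g z"
proof -
  have "(\<lambda>z. f z - g z) analytic_on {0}"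
    by (intro analytic_intros assms)
  moreover have "\<exists>\<^sub>F z in at 0. f z - g z = 0"
  proof -
    have lim: "filterlim complex_of_real (at 0) (at 0)"
      unfolding filterlim_at by (auto simp: eventually_at_filter intro!: tendsto_eq_intros)
    have "\<forall>\<^sub>F x in at 0. f (complex_of_real x) - g (complex_of_real x) = 0"
      using eq unfolding eventually_at_filter by eventually_elim simp
    hence "\<exists>\<^sub>F x in at 0. f (complex_of_real x) - g (complex_of_real x) = 0"
      by (intro eventually_frequently) auto
    thus ?thesis
      unfolding frequently_def using eventually_compose_filterlim[OF _ lim] by blast
  qed
  ultimately have "\<forall>\<^sub>F z in at 0. f z - g z = 0"
    by (intro not_essential_frequently_0_imp_eventually_0 isolated_singularity_at_analytic
      not_essential_analytic)
  \<comment> \<open>The identity theorem yields a punctured neighbourhood; the value at 0 comes from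
    the real point 0.\<close>
  moreover have "f 0 = g 0"
    using eventually_nhds_x_imp_x[OF eq] by simp
  ultimately show ?thesis
    by (auto simp: eventually_at_filter elim: eventually_mono)
qed

text \<open>The map \<open>h\<close>, which is \<open>m / V m\<close> continued to complex
  \<open>m\<close>, has the explicit right inverse \<mu>. Substituting \<open>\<mu> z\<close> for
  \<open>m\<close> in the continued mass identity gives the inversion condition of
  \<open>R_transform_eqI\<close>.\<close>

lemma gamma_Meixner_R_transform:
  assumes \<nu>: "real_distribution \<nu>" "compactly_supported \<nu>"
    and gen: "generates_free_exp_family \<nu> 0 (\<lambda>m. (1 + a * m)\<^sup>2)"
  shows "\<forall>\<^sub>F z in nhds 0. R_transform \<nu> z = z * (catalan_gf (complex_of_real a * z))\<^sup>2"
proof (rule R_transform_eqI[OF \<nu>])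
  define b where "b = complex_of_real a"
  define h where "h m = m / (1 + b * m)\<^sup>2" for m
  define \<mu> where "\<mu> z = z * (catalan_gf (b * z))\<^sup>2" for z
  have "catalan_gf \<circ> (\<lambda>z. b * z) analytic_on {0}"
    by (intro analytic_on_compose_gen[OF _ catalan_gf_analytic] analytic_intros) auto
  hence \<mu>: "\<mu> analytic_on {0}"
    unfolding \<mu>_def o_def by (intro analytic_intros)
  thus "(\<lambda>z. z * (catalan_gf (complex_of_real a * z))\<^sup>2) analytic_on {0}"
    unfolding \<mu>_def[abs_def] b_def .
  have h: "h analytic_on {0}"
    unfolding h_def by (intro analytic_intros) auto
  have h0: "h 0 = 0" by (simp add: h_def)
  have h_\<mu>: "h (\<mu> z) = z" for z
  proof -
    \<comment> \<open>This is the Catalan equation at \<open>t = b * z\<close>; the square in the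
      denominator of \<open>h\<close> then cancels the square in \<mu>.\<close>
    have "1 + b * \<mu> z = catalan_gf (b * z)"
      by (subst catalan_gf_eq) (simp add: \<mu>_def)
    thus ?thesis
      using catalan_gf_nonzero by (simp add: h_def) (simp add: \<mu>_def)
  qed
  have "(\<lambda>m. h m / (1 + m * h m)) analytic_on {0}"
    by (intro analytic_intros h) (auto simp: h0)
  hence "cauchy_transform_inf \<nu> \<circ> (\<lambda>m. h m / (1 + m * h m)) analytic_on {0}"
    by (rule analytic_on_compose_gen[OF _ cauchy_transform_inf_analytic[OF \<nu>]]) (simp add: h0)
  moreover have "\<forall>\<^sub>F m in nhds 0. (cauchy_transform_inf \<nu> \<circ> (\<lambda>m. h m / (1 + m * h m))) (complex_of_real m)
      = h (complex_of_real m)"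
    using cauchy_transform_inf_of_real[OF gen \<nu>(1)]
    by eventually_elim (simp add: h_def b_def)
  ultimately have "\<forall>\<^sub>F m in nhds 0. (cauchy_transform_inf \<nu> \<circ> (\<lambda>m. h m / (1 + m * h m))) m = h m"
    using h by (intro analytic_eq_of_real_imp_eventually_eq)
  hence ev: "\<forall>\<^sub>F m in nhds 0. cauchy_transform_inf \<nu> (h m / (1 + m * h m)) = h m"
    by simp
  have "filterlim \<mu> (nhds 0) (nhds 0)"
    by (rule analytic_at_imp_tendsto_nhds[OF \<mu>]) (simp add: \<mu>_def)
  from eventually_compose_filterlim[OF ev this]
  have "\<forall>\<^sub>F z in nhds 0. cauchy_transform_inf \<nu> (z / (1 + z * \<mu> z)) = z"
    by (simp add: h_\<mu> mult.commute)
  thus "\<forall>\<^sub>F z in nhds 0. cauchy_transform_inf \<nu>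
      (z / (1 + z * (z * (catalan_gf (complex_of_real a * z))\<^sup>2))) = z"
    by (simp add: \<mu>_def b_def)
qed

theorem corollary3p4:
  fixes a :: real and \<nu> :: "real measure" and k :: nat
  assumes "real_distribution \<nu>"
    and "compactly_supported \<nu>"
    and "generates_free_exp_family \<nu> 0 (\<lambda>m. (1 + a * m)\<^sup>2)"
    and "k \<ge> 1"
  shows "free_cumulant \<nu> (k + 1) =
    complex_of_real (1 / real (k + 1) * real ((2 * k) choose k) * a ^ (k - 1))"
proof -
  obtain n where k: "k = Suc n"
    using assms(4) by (cases k) auto
  \<comment> \<open>An expansion depends only on the germ at 0, so eventual equality suffices; the
    shift in \<open>free_cumulant\<close> makes the index \<open>k\<close>, that is
    \<open>Suc n\<close>.\<close>
  have "free_cumulant \<nu> (k + 1)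
      = fps_nth (fps_expansion (\<lambda>z. z * (catalan_gf (complex_of_real a * z))\<^sup>2) 0) (Suc n)"
    unfolding free_cumulant_def fps_expansion_cong[OF gamma_Meixner_R_transform[OF assms(1-3)]]
    by (simp add: k)
  also have "\<dots> = of_nat ((2 * k) choose k) / of_nat (k + 1) * complex_of_real a ^ (k - 1)"
    unfolding gamma_Meixner_R_coeff by (simp add: k)
  finally show ?thesis
    by simp
qed

end
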